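(* Let $n\ge 1$, let $\mu$ be a partition with at most $n$ parts (regarded as a weak composition with $n$ parts by appending zeros), and let $\alpha$ be a weak composition with $n$ parts. Then the product of Demazure atoms $\mathcal{A}_\mu\cdot\mathcal{A}_\alpha$ is atom-positive, i.e. there are nonnegative integers $c_\beta$ such that $\mathcal{A}_\mu\cdot\mathcal{A}_\alpha=\sum_{\beta}c_\beta\,\mathcal{A}_\beta$, the sum running over weak compositions $\beta$.
   Context: Let $P=\mathbb{Z}[x_1,x_2,\dots]$. For $i\ge1$ let $s_i$ act on $P$ by swapping $x_i$ and $x_{i+1}$, and define operators $\partial_i f=\frac{f-s_if}{x_i-x_{i+1}}$ and $\theta_i f=x_{i+1}\partial_i f$. For a permutation $w$ with reduced decomposition $w=s_{i_1}\cdots s_{i_l}$ put $\theta_w=\theta_{i_1}\cdots\theta_{i_l}$ (composition of operators; independent of the reduced word), with $\theta_{\mathrm{id}}$ the identity. For a weak composition $\gamma=(\gamma_1,\dots,\gamma_n)$ write $x^\gamma=x_1^{\gamma_1}\cdots x_n^{\gamma_n}$; $s_i$ acts on weak compositions by swapping the $i$-th and $(i+1)$-th entries. Let $\lambda$ be the partition obtained by sorting $\gamma$ into weakly decreasing order and let $w$ be the permutation of minimal length with $w\cdot\lambda=\gamma$ (where $s_{i_1}\cdots s_{i_l}\cdot\lambda$ means apply $s_{i_l}$ first). The Demazure atom is $\mathcal{A}_\gamma=\theta_w x^\lambda$. (For a partition $\mu$, $\mathcal{A}_\mu=x^\mu$.) The atoms form a basis of $P$ (over weak compositions of all lengths). 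*)

theory Defs
  imports "HOL-Library.Poly_Mapping"
begin

(* P = Z[x_1, x_2, ...]: polynomials are finitely supported maps from monomials
   (exponent vectors nat =>0 nat, index j = exponent of x_j; index 0 unused) to int. *)
type_synonym poly = "(nat \<Rightarrow>\<^sub>0 nat) \<Rightarrow>\<^sub>0 int"

definition var :: "nat \<Rightarrow> poly" where
  "var j = Poly_Mapping.single (Poly_Mapping.single j 1) 1"

definition tr :: "nat \<Rightarrow> nat \<Rightarrow> nat" where
  "tr i j = (if j = i then i + 1 else if j = i + 1 then i else j)"

definition s_poly :: "nat \<Rightarrow> poly \<Rightarrow> poly" where
  "s_poly i f = Poly_Mapping.map_key (\<lambda>m. Poly_Mapping.map_key (tr i) m) f"

definition dd :: "nat \<Rightarrow> poly \<Rightarrow> poly" where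
  "dd i f = (THE q. (var i - var (i + 1)) * q = f - s_poly i f)"

definition theta :: "nat \<Rightarrow> poly \<Rightarrow> poly" where
  "theta i f = var (i + 1) * dd i f"

definition theta_word :: "nat list \<Rightarrow> poly \<Rightarrow> poly" where
  "theta_word ws = foldr (\<lambda>i g. theta i \<circ> g) ws id"

(* weak compositions as lists; gamma!0 is the exponent of x_1 *)
definition xpow :: "nat list \<Rightarrow> poly" where
  "xpow \<gamma> = (\<Prod>j<length \<gamma>. var (j + 1) ^ (\<gamma> ! j))"

(* s_i on weak compositions: swap the i-th and (i+1)-th entries (1-based) *)
definition s_comp :: "nat \<Rightarrow> nat list \<Rightarrow> nat list" where
  "s_comp i \<gamma> = (if 1 \<le> i \<and> i < length \<gamma>
      then \<gamma>[i - 1 := \<gamma> ! i, i := \<gamma> ! (i - 1)] else \<gamma>)"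

definition word_act :: "nat list \<Rightarrow> nat list \<Rightarrow> nat list" where
  "word_act ws \<gamma> = foldr s_comp ws \<gamma>"

definition sort_dec :: "nat list \<Rightarrow> nat list" where
  "sort_dec \<gamma> = rev (sort \<gamma>)"

(* a word of minimal length among all words w with w . lambda = gamma; such a word is a
   reduced word of the minimal-length permutation w with w . lambda = gamma *)
definition min_word :: "nat list \<Rightarrow> nat list" where
  "min_word \<gamma> = (SOME ws. (\<forall>i\<in>set ws. 1 \<le> i) \<and> word_act ws (sort_dec \<gamma>) = \<gamma> \<and>
      (\<forall>vs. (\<forall>i\<in>set vs. 1 \<le> i) \<and> word_act vs (sort_dec \<gamma>) = \<gamma> \<longrightarrow> length ws \<le> length vs))"

definition atom :: "nat list \<Rightarrow> poly" where
  "atom \<gamma> = theta_word (min_word \<gamma>) (xpow (sort_dec \<gamma>))"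

end

theory Submission
  imports Defs "HOL-Library.Multiset"
begin

text \<open>Let \<open>E\<^sub>k = x\<^sub>1 \<cdots> x\<^sub>k\<close>. Since \<open>x\<^sup>\<mu>\<close> is a product of such monomials, it suffices to multiply an atom
  \<open>\<A>\<^sub>\<gamma>\<close> by one \<open>E\<^sub>k\<close>. For \<open>i \<noteq> k\<close> the operator \<open>\<theta>\<^sub>i\<close> commutes with \<open>E\<^sub>k\<close>, so sorting the first
  \<open>k\<close> and the remaining entries of \<open>\<gamma>\<close> separately gives \<open>E\<^sub>k \<A>\<^sub>\<gamma> = \<theta>\<^sub>v (E\<^sub>k \<theta>\<^sub>w x\<^sup>\<lambda>)\<close> with \<open>w\<close> a
  minimal coset representative. With \<open>\<pi>\<^sub>i = 1 + \<theta>\<^sub>i\<close> one has \<open>x\<^sub>i \<theta>\<^sub>i = \<pi>\<^sub>i x\<^sub>i\<^sub>+\<^sub>1\<close>, which moves \<open>E\<^sub>k\<close>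
  through \<open>\<theta>\<^sub>w\<close> and shows that \<open>E\<^sub>k \<theta>\<^sub>w x\<^sup>\<lambda> = \<pi>\<^sub>w x\<^sup>\<nu>\<close> is a key polynomial (\<open>\<nu>\<close> is again a
  partition). Finally \<open>\<theta>\<^sub>v \<pi>\<^sub>i\<close> is \<open>\<theta>\<^sub>v + \<theta>\<^bsub>v s\<^sub>i\<^esub>\<close> if \<open>v s\<^sub>i\<close> is longer than \<open>v\<close> and \<open>0\<close> otherwise,
  so \<open>\<theta>\<^sub>v \<pi>\<^sub>w x\<^sup>\<nu>\<close> is a sum of terms \<open>\<theta>\<^sub>u x\<^sup>\<nu>\<close>, each of which is an atom or zero.\<close>

section \<open>Divided differences\<close>

lemma poly_mapping_single_induct [case_names zero add]:
  fixes f :: "'a \<Rightarrow>\<^sub>0 'b::monoid_add"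
  assumes "P 0" and "\<And>f k v. P f \<Longrightarrow> P (f + Poly_Mapping.single k v)"
  shows "P f"
proof (induction f rule: update_induct)
  case const
  then show ?case by (rule assms(1))
next
  case (update f k v)
  have "Poly_Mapping.update k v f = f + Poly_Mapping.single k v"
    using update(1)
    by (intro poly_mapping_eqI) (auto simp: lookup_update lookup_add lookup_single when_def in_keys_iff)
  then show ?case using assms(2) update by simp
qed

section \<open>Action of the transpositions on polynomials\<close>

lemma tr_tr [simp]: "tr i (tr i j) = j"
  by (auto simp: tr_def)

lemma tr_comp_tr [simp]: "tr i \<circ> tr i = id"
  by (auto simp: fun_eq_iff)

lemma inj_tr [simp]: "inj (tr i)"
  by (metis injI tr_tr)

lemma tr_left [simp]: "tr i i = Suc i" and tr_right [simp]: "tr i (Suc i) = i"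
  by (auto simp: tr_def)

lemma map_key_tr_tr [simp]: "Poly_Mapping.map_key (tr i) (Poly_Mapping.map_key (tr i) m) = m"
  by (intro poly_mapping_eqI) (simp add: map_key.rep_eq)

lemma inj_map_key_tr [simp]: "inj (Poly_Mapping.map_key (tr i))"
  by (metis injI map_key_tr_tr)

lemma s_poly_single [simp]:
  "s_poly i (Poly_Mapping.single m c) = Poly_Mapping.single (Poly_Mapping.map_key (tr i) m) c"
  using map_key_single[OF inj_map_key_tr, of i "Poly_Mapping.map_key (tr i) m" c]
  by (simp add: s_poly_def)

lemma s_poly_0 [simp]: "s_poly i 0 = 0"
  by (simp add: s_poly_def)

lemma s_poly_add [simp]: "s_poly i (f + g) = s_poly i f + s_poly i g"
  by (simp add: s_poly_def map_key_plus)

lemma s_poly_uminus [simp]: "s_poly i (- f) = - s_poly i f"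
  by (metis add.inverse_unique s_poly_0 s_poly_add right_minus)

lemma s_poly_diff [simp]: "s_poly i (f - g) = s_poly i f - s_poly i g"
  by (metis diff_conv_add_uminus s_poly_add s_poly_uminus)

lemma s_poly_mult [simp]: "s_poly i (f * g) = s_poly i f * s_poly i g"
proof (induction f rule: poly_mapping_single_induct)
  case (add f k v)
  have "s_poly i (Poly_Mapping.single k v * g) = s_poly i (Poly_Mapping.single k v) * s_poly i g"
    by (induction g rule: poly_mapping_single_induct)
      (simp_all add: distrib_left mult_single map_key_plus)
  then show ?case using add by (simp add: distrib_right)
qed simp

lemma s_poly_1 [simp]: "s_poly i 1 = 1"
  using s_poly_single[of i 0 1] by simp

lemma s_poly_s_poly [simp]: "s_poly i (s_poly i f) = f"
  by (induction f rule: poly_mapping_single_induct) simp_all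

lemma s_poly_var [simp]: "s_poly i (var j) = var (tr i j)"
  using map_key_single[OF inj_tr, of i "tr i j" "1::nat"] by (simp add: var_def)

lemma s_poly_power [simp]: "s_poly i (f ^ k) = s_poly i f ^ k"
  by (induction k) simp_all

lemma s_poly_prod: "s_poly i (\<Prod>j\<in>A. f j) = (\<Prod>j\<in>A. s_poly i (f j))"
  by (induction A rule: infinite_finite_induct) simp_all

text \<open>Relabelling exponents is precomposition, which reverses the order of composition. This
  accounts for the swapped indices in the conclusion.\<close>

lemma s_poly_comp_eqI:
  assumes "tr i \<circ> tr j = tr k \<circ> tr l"
  shows "s_poly j (s_poly i f) = s_poly l (s_poly k f)"
proof (induction f rule: poly_mapping_single_induct)
  case (add f m v)
  then show ?case by (simp add: map_key_compose assms)
qed simp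

lemma var_eq_iff [simp]: "var i = var j \<longleftrightarrow> i = j"
proof
  assume "var i = var j"
  then have "Poly_Mapping.keys (var i) = Poly_Mapping.keys (var j)" by simp
  then have "Poly_Mapping.single i (1::nat) = Poly_Mapping.single j 1" by (simp add: var_def)
  then have "Poly_Mapping.keys (Poly_Mapping.single i (1::nat)) = Poly_Mapping.keys (Poly_Mapping.single j (1::nat))"
    by simp
  then show "i = j" by simp
qed simp

text \<open>The polynomials with such a quotient are closed under sums and, by the twisted Leibniz
  rule, under products. They contain the constants and the variables, hence everything.\<close>

lemma dd_exists: "\<exists>q. (var i - var (i + 1)) * q = f - s_poly i f"
proof -
  let ?D = "{f. \<exists>q. (var i - var (i + 1)) * q = f - s_poly i f}"
  have plus: "f + g \<in> ?D" if fg: "f \<in> ?D" "g \<in> ?D" for f g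
  proof -
    obtain p q where "(var i - var (i + 1)) * p = f - s_poly i f"
      "(var i - var (i + 1)) * q = g - s_poly i g"
      using fg by blast
    then have "(var i - var (i + 1)) * (p + q) = (f + g) - s_poly i (f + g)"
      by (simp add: algebra_simps)
    then show ?thesis by blast
  qed
  have mult: "f * g \<in> ?D" if fg: "f \<in> ?D" "g \<in> ?D" for f g
  proof -
    obtain p q where p: "(var i - var (i + 1)) * p = f - s_poly i f"
      and q: "(var i - var (i + 1)) * q = g - s_poly i g"
      using fg by blast
    have "(var i - var (i + 1)) * (p * g + s_poly i f * q)
        = ((var i - var (i + 1)) * p) * g + s_poly i f * ((var i - var (i + 1)) * q)"
      by (simp add: algebra_simps)
    also have "\<dots> = f * g - s_poly i (f * g)"
      unfolding p q by (simp add: algebra_simps)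
    finally show ?thesis by blast
  qed
  have sym: "f \<in> ?D" if "s_poly i f = f" for f
    using that by (intro CollectI exI[of _ 0]) simp
  have var: "var j \<in> ?D" for j
  proof -
    consider "j = i" | "j = i + 1" | "tr i j = j"
      by (cases "j = i"; cases "j = i + 1") (auto simp: tr_def)
    then show ?thesis
    proof cases
      case 1
      then have "(var i - var (i + 1)) * 1 = var j - s_poly i (var j)" by simp
      then show ?thesis by blast
    next
      case 2
      then have "(var i - var (i + 1)) * (- 1) = var j - s_poly i (var j)" by simp
      then show ?thesis by blast
    next
      case 3
      then show ?thesis by (intro sym) simp
    qed
  qed
  have pow: "Poly_Mapping.single (Poly_Mapping.single j e) 1 \<in> ?D" for j e
  proof (induction e)
    case 0
    then show ?case by (intro sym) simp
  next
    case (Suc e)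
    have "Poly_Mapping.single (Poly_Mapping.single j (Suc e)) 1
        = var j * Poly_Mapping.single (Poly_Mapping.single j e) (1::int)"
      by (simp add: var_def mult_single single_add[symmetric])
    then show ?case using mult[OF var Suc] by simp
  qed
  have mono: "Poly_Mapping.single m 1 \<in> ?D" for m
  proof (induction m rule: poly_mapping_single_induct)
    case zero
    then show ?case by (intro sym) simp
  next
    case (add m j e)
    have "Poly_Mapping.single (m + Poly_Mapping.single j e) 1
        = Poly_Mapping.single m 1 * Poly_Mapping.single (Poly_Mapping.single j e) (1::int)"
      by (simp add: mult_single)
    then show ?case using mult[OF add pow] by simp
  qed
  have "f \<in> ?D"
  proof (induction f rule: poly_mapping_single_induct)
    case zero
    then show ?case by (intro sym) simp
  next
    case (add f m c)
    have "Poly_Mapping.single m c = Poly_Mapping.single 0 c * Poly_Mapping.single m 1"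
      by (simp add: mult_single)
    moreover have "Poly_Mapping.single 0 c \<in> ?D"
      by (intro sym) simp
    ultimately have "Poly_Mapping.single m c \<in> ?D"
      using mult[OF _ mono] by (simp only:)
    then show ?case by (rule plus[OF add])
  qed
  then show ?thesis by blast
qed

text \<open>Cancellation in an integral domain makes the description in \<open>dd\<close> well
  defined. With \<open>dd_exists\<close>, identities for \<open>dd\<close> can be checked after
  multiplying by \<open>var i - var (i + 1)\<close>.\<close>

lemma dd_unique: "(var i - var (i + 1)) * q = f - s_poly i f \<Longrightarrow> dd i f = q"
  unfolding dd_def
proof (rule the_equality)
  fix q' assume q: "(var i - var (i + 1)) * q = f - s_poly i f"
    and "(var i - var (i + 1)) * q' = f - s_poly i f"
  then have "(var i - var (i + 1)) * q' = (var i - var (i + 1)) * q" by simp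
  moreover have "var i - var (i + 1) \<noteq> 0" by simp
  ultimately show "q' = q" by (metis mult_left_cancel)
qed

lemma dd_eq: "(var i - var (Suc i)) * dd i f = f - s_poly i f"
  using dd_exists[of i f] dd_unique[of i _ f] by auto

lemma dd_add: "dd i (f + g) = dd i f + dd i g"
  by (rule dd_unique) (simp add: dd_eq distrib_left)

lemma s_poly_dd: "s_poly i (dd i f) = dd i f"
proof -
  have "(var i - var (Suc i)) * s_poly i (dd i f) = - s_poly i ((var i - var (Suc i)) * dd i f)"
    by (simp add: algebra_simps)
  also have "\<dots> = (var i - var (Suc i)) * dd i f"
    unfolding dd_eq by simp
  finally show ?thesis
    using mult_left_cancel[of "var i - var (Suc i)"] by simp
qed

lemma dd_mult: "dd i (f * g) = dd i f * g + s_poly i f * dd i g"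
proof (rule dd_unique)
  have "(var i - var (i + 1)) * (dd i f * g + s_poly i f * dd i g)
      = ((var i - var (Suc i)) * dd i f) * g + s_poly i f * ((var i - var (Suc i)) * dd i g)"
    by (simp add: algebra_simps)
  also have "\<dots> = f * g - s_poly i (f * g)"
    unfolding dd_eq by (simp add: algebra_simps)
  finally show "(var i - var (i + 1)) * (dd i f * g + s_poly i f * dd i g) = f * g - s_poly i (f * g)" .
qed

lemma dd_sym: "s_poly i f = f \<Longrightarrow> dd i f = 0"
  by (rule dd_unique) simp

lemma dd_sym_mult: "s_poly i f = f \<Longrightarrow> dd i (f * g) = f * dd i g"
  by (simp add: dd_mult dd_sym)

lemma dd_var_right [simp]: "dd i (var (Suc i)) = -1"
  by (rule dd_unique) simp

lemma dd_dd [simp]: "dd i (dd i f) = 0"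
  by (simp add: dd_sym s_poly_dd)

section \<open>The operators \<open>\<theta>\<^sub>i\<close> and their relations\<close>

lemma theta_add: "theta i (f + g) = theta i f + theta i g"
  by (simp add: theta_def dd_add distrib_left)

lemma theta_sym: "s_poly i f = f \<Longrightarrow> theta i f = 0"
  by (simp add: theta_def dd_sym)

lemma theta_sym_mult: "s_poly i f = f \<Longrightarrow> theta i (f * g) = f * theta i g"
  by (simp add: theta_def dd_sym_mult)

text \<open>The factor \<open>dd i f\<close> is symmetric and \<open>var (Suc i)\<close> has divided
  difference -1. Equivalently \<open>\<theta>\<^sub>i \<pi>\<^sub>i = 0\<close>, the source of the
  vanishing terms below.\<close>

lemma theta_theta: "theta i (theta i f) = - theta i f"
  by (simp add: theta_def dd_mult s_poly_dd)

text \<open>The operator \<open>f \<mapsto> f + \<theta>\<^sub>i f\<close> is the isobaric divided difference \<open>\<pi>\<^sub>i\<close>.\<close>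

lemma var_mult_theta: "var i * theta i f = var (Suc i) * f + theta i (var (Suc i) * f)"
  unfolding theta_def by (subst dd_mult) (simp add: algebra_simps)

text \<open>Multiplied by both denominators, either side becomes the same alternating sum over the
  group generated by the commuting swaps \<open>s\<^sub>i\<close> and
  \<open>s\<^sub>j\<close>.\<close>

lemma dd_commute:
  assumes "Suc i < j"
  shows "dd i (dd j f) = dd j (dd i f)"
proof -
  have s: "s_poly j (s_poly i g) = s_poly i (s_poly j g)" for g
    using assms by (intro s_poly_comp_eqI) (auto simp: fun_eq_iff tr_def)
  have [simp]: "tr i j = j" "tr i (Suc j) = Suc j" "tr j i = i" "tr j (Suc i) = Suc i"
    using assms by (auto simp: tr_def)
  let ?x = "var i - var (Suc i)" and ?y = "var j - var (Suc j)"
  have 1: "?y * dd j f = f - s_poly j f" and 2: "?x * dd i f = f - s_poly i f"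
    by (rule dd_eq)+
  have 3: "?y * s_poly i (dd j f) = s_poly i f - s_poly i (s_poly j f)"
    using arg_cong[OF 1, of "s_poly i"] by simp
  have 4: "?x * s_poly j (dd i f) = s_poly j f - s_poly i (s_poly j f)"
    using arg_cong[OF 2, of "s_poly j"] by (simp add: s)
  have "?x * ?y * dd i (dd j f) = ?y * (?x * dd i (dd j f))" by (simp add: algebra_simps)
  also have "\<dots> = ?y * dd j f - ?y * s_poly i (dd j f)"
    unfolding dd_eq[of i "dd j f"] by (simp add: algebra_simps)
  also have "\<dots> = ?x * dd i f - ?x * s_poly j (dd i f)" unfolding 1 2 3 4 by simp
  also have "\<dots> = ?x * (?y * dd j (dd i f))"
    unfolding dd_eq[of j "dd i f"] by (simp add: algebra_simps)
  finally have "(?x * ?y) * dd i (dd j f) = (?x * ?y) * dd j (dd i f)" by (simp add: algebra_simps)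
  moreover have "?x * ?y \<noteq> 0" using assms by simp
  ultimately show ?thesis by (metis mult_left_cancel)
qed

lemma theta_commute_less:
  assumes "Suc i < j"
  shows "theta i (theta j f) = theta j (theta i f)"
proof -
  have s: "s_poly i (var (Suc j)) = var (Suc j)" "s_poly j (var (Suc i)) = var (Suc i)"
    using assms by (auto simp: tr_def)
  then show ?thesis
    by (simp add: theta_def dd_sym_mult[OF s(1)] dd_sym_mult[OF s(2)] dd_commute[OF assms]
        mult.left_commute)
qed

lemma theta_commute: "Suc i < j \<or> Suc j < i \<Longrightarrow> theta i (theta j f) = theta j (theta i f)"
  using theta_commute_less by metis

lemma tr_tr_braid: "tr i \<circ> tr (Suc i) \<circ> tr i = tr (Suc i) \<circ> tr i \<circ> tr (Suc i)"
proof
  fix x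
  consider "x = i" | "x = Suc i" | "x = Suc (Suc i)" | "x \<notin> {i, Suc i, Suc (Suc i)}" by blast
  then show "(tr i \<circ> tr (Suc i) \<circ> tr i) x = (tr (Suc i) \<circ> tr i \<circ> tr (Suc i)) x"
    by cases (simp_all add: tr_def)
qed

lemma s_poly_braid:
  "s_poly i (s_poly (Suc i) (s_poly i f)) = s_poly (Suc i) (s_poly i (s_poly (Suc i) f))"
proof (induction f rule: poly_mapping_single_induct)
  case (add f m v)
  show ?case using add by (simp add: map_key_compose inj_compose o_assoc tr_tr_braid)
qed simp

text \<open>Multiplied by the Vandermonde product \<open>?V\<close> of the three variables, both
  sides become the alternating sum \<open>W\<close> of \<open>f\<close> over the six permutations of
  these variables.\<close>

lemma dd_braid:
  "dd i (dd (Suc i) (dd i f)) = dd (Suc i) (dd i (dd (Suc i) f))"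
proof -
  let ?j = "Suc i"
  define a b c where "a = var i" and "b = var (Suc i)" and "c = var (Suc (Suc i))"
  have [simp]: "s_poly i a = b" "s_poly i b = a" "s_poly i c = c"
    "s_poly ?j a = a" "s_poly ?j b = c" "s_poly ?j c = b"
    by (simp_all add: a_def b_def c_def tr_def)
  have di: "(a - b) * dd i g = g - s_poly i g" and dj: "(b - c) * dd ?j g = g - s_poly ?j g" for g
    using dd_eq[of i g] dd_eq[of ?j g] by (simp_all add: a_def b_def c_def)
  have ne: "a - b \<noteq> 0" "b - c \<noteq> 0" "a - c \<noteq> 0" by (simp_all add: a_def b_def c_def)
  define g h where "g = dd ?j (dd i f)" and "h = dd i (dd ?j f)"
  have sdi: "(a - c) * s_poly ?j (dd i f) = s_poly ?j f - s_poly ?j (s_poly i f)"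
    using arg_cong[OF di[of f], of "s_poly ?j"] by simp
  have sdj: "(a - c) * s_poly i (dd ?j f) = s_poly i f - s_poly i (s_poly ?j f)"
    using arg_cong[OF dj[of f], of "s_poly i"] by simp
  let ?V = "(a - b) * (a - c) * (b - c)"
  have "?V * g = (a - b) * (a - c) * ((b - c) * g)" by (simp add: algebra_simps)
  also have "\<dots> = (a - c) * ((a - b) * dd i f) - (a - b) * ((a - c) * s_poly ?j (dd i f))"
    unfolding g_def dj by (simp add: algebra_simps)
  also have "\<dots> = (a - c) * (f - s_poly i f) - (a - b) * (s_poly ?j f - s_poly ?j (s_poly i f))"
    unfolding sdi di by simp
  finally have g: "?V * g = \<dots>" .
  have sg: "- ?V * s_poly i g
      = (b - c) * (s_poly i f - f)
        - (b - a) * (s_poly i (s_poly ?j f) - s_poly i (s_poly ?j (s_poly i f)))"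
    using arg_cong[OF g, of "s_poly i"] by (simp add: algebra_simps)
  have "?V * h = (b - c) * (a - c) * ((a - b) * h)" by (simp add: algebra_simps)
  also have "\<dots> = (a - c) * ((b - c) * dd ?j f) - (b - c) * ((a - c) * s_poly i (dd ?j f))"
    unfolding h_def di by (simp add: algebra_simps)
  also have "\<dots> = (a - c) * (f - s_poly ?j f) - (b - c) * (s_poly i f - s_poly i (s_poly ?j f))"
    unfolding sdj dj by simp
  finally have h: "?V * h = \<dots>" .
  have sh: "- ?V * s_poly ?j h
      = (a - b) * (s_poly ?j f - f)
        - (c - b) * (s_poly ?j (s_poly i f) - s_poly i (s_poly ?j (s_poly i f)))"
    using arg_cong[OF h, of "s_poly ?j"] by (simp add: algebra_simps s_poly_braid)
  define W where "W = f - s_poly i f - s_poly ?j f + s_poly i (s_poly ?j f)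
      + s_poly ?j (s_poly i f) - s_poly i (s_poly ?j (s_poly i f))"
  have "(a - b) * (?V * dd i g) = ?V * ((a - b) * dd i g)" by (simp add: algebra_simps)
  also have "\<dots> = ?V * g + - ?V * s_poly i g" unfolding di by (simp add: algebra_simps)
  also have "\<dots> = (a - b) * W" unfolding g sg W_def by (simp add: algebra_simps)
  finally have 1: "?V * dd i g = W" using ne by simp
  have "(b - c) * (?V * dd ?j h) = ?V * ((b - c) * dd ?j h)" by (simp add: algebra_simps)
  also have "\<dots> = ?V * h + - ?V * s_poly ?j h" unfolding dj by (simp add: algebra_simps)
  also have "\<dots> = (b - c) * W" unfolding h sh W_def by (simp add: algebra_simps)
  finally have 2: "?V * dd ?j h = W" using ne by simp
  show ?thesis
    using 1 2 ne mult_left_cancel[of ?V "dd i g" "dd ?j h"] by (simp add: g_def h_def)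
qed

text \<open>Pulling the variables out of the divided differences leaves the same monomial
  \<open>?b * ?c * ?c\<close> on both sides, so \<open>dd_braid\<close> applies.\<close>

lemma theta_braid:
  "theta i (theta (Suc i) (theta i f)) = theta (Suc i) (theta i (theta (Suc i) f))"
proof -
  let ?j = "Suc i" and ?b = "var (Suc i)" and ?c = "var (Suc (Suc i))"
  have c: "s_poly i ?c = ?c" and bc: "s_poly ?j (?b * ?c) = ?b * ?c"
    by (simp_all add: tr_def)
  \<comment> \<open>Used with \<open>g = dd i f\<close>: the summand \<open>g\<close> is then killed
    by the outer \<open>dd i\<close>.\<close>
  have "dd ?j (?b * g) = g + ?c * dd ?j g" for g
  proof -
    have "dd ?j ?b = 1" by (rule dd_unique) simp
    then show ?thesis by (subst dd_mult) simp
  qed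
  then have "theta i (theta ?j (theta i f)) = ?b * ?c * (?c * dd i (dd ?j (dd i f)))"
    by (simp add: theta_def dd_sym_mult[OF c] dd_add)
  moreover have "theta ?j (theta i (theta ?j f)) = ?c * (dd ?j ((?b * ?c) * dd i (dd ?j f)))"
    by (simp add: theta_def dd_sym_mult[OF c] mult.assoc)
  ultimately show ?thesis
    by (simp only: dd_sym_mult[OF bc] dd_braid) (simp add: algebra_simps)
qed

lemma theta_word_Nil [simp]: "theta_word [] f = f"
  by (simp add: theta_word_def)

lemma theta_word_Cons [simp]: "theta_word (i # ws) f = theta i (theta_word ws f)"
  by (simp add: theta_word_def)

lemma theta_word_append: "theta_word (us @ ws) f = theta_word us (theta_word ws f)"
  by (induction us) simp_all

lemma theta_word_add: "theta_word ws (f + g) = theta_word ws f + theta_word ws g"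
  by (induction ws) (simp_all add: theta_add)

lemma theta_word_0 [simp]: "theta_word ws 0 = 0"
  by (induction ws) (simp_all add: theta_sym)

section \<open>Reduced words acting on compositions\<close>

text \<open>A composition with \<open>n\<close> parts is encoded as a function on positions \<open>1, \<dots>, n\<close>, so that
  \<open>s\<^sub>i\<close> becomes precomposition with \<^term>\<open>tr i\<close>. Every step of a word in
  \<open>red n g ws h\<close> swaps a strict descent; from a weakly decreasing \<open>g\<close> these are the words
  of minimal length.\<close>

inductive red :: "nat \<Rightarrow> (nat \<Rightarrow> nat) \<Rightarrow> nat list \<Rightarrow> (nat \<Rightarrow> nat) \<Rightarrow> bool" for n g where
  red_Nil: "red n g [] g"
| red_Cons: "red n g ws h \<Longrightarrow> 1 \<le> i \<Longrightarrow> i < n \<Longrightarrow> h (Suc i) < h i \<Longrightarrow> red n g (i # ws) (h \<circ> tr i)"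

definition dec :: "nat \<Rightarrow> (nat \<Rightarrow> nat) \<Rightarrow> bool" where
  "dec n g \<longleftrightarrow> (\<forall>i. 1 \<le> i \<and> i < n \<longrightarrow> g (Suc i) \<le> g i)"

lemma dec_on_antimono:
  assumes "\<And>i. a \<le> i \<Longrightarrow> i < b \<Longrightarrow> g (Suc i) \<le> (g i :: nat)" "a \<le> p" "p \<le> q" "q \<le> b"
  shows "g q \<le> g p"
  using assms(3,4)
proof (induction q rule: dec_induct)
  case base
  then show ?case by simp
next
  case (step q)
  then show ?case using assms(1)[of q] assms(2) by fastforce
qed

lemma dec_antimono: "dec n g \<Longrightarrow> 1 \<le> p \<Longrightarrow> p \<le> q \<Longrightarrow> q \<le> n \<Longrightarrow> g q \<le> g p"
  by (rule dec_on_antimono[where a = 1 and b = n]) (auto simp: dec_def)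

lemma comp_tr_tr [simp]: "h \<circ> tr i \<circ> tr i = h"
  by (simp add: o_assoc[symmetric])

lemma tr_range: "1 \<le> i \<Longrightarrow> i < n \<Longrightarrow> 1 \<le> tr i j \<and> tr i j \<le> n \<longleftrightarrow> 1 \<le> j \<and> j \<le> n"
  by (auto simp: tr_def)

lemma tr_tr_commute: "Suc i < j \<or> Suc j < i \<Longrightarrow> tr i \<circ> tr j = tr j \<circ> tr i"
  by (auto simp: fun_eq_iff tr_def)

text \<open>The exchange property: an ascent \<open>i\<close> of \<open>h\<close> can be made the
  first letter without changing the operator. The first letter \<open>j\<close> of the word equals
  \<open>i\<close>, commutes with it, or is adjacent to it and calls for a braid move. The induction
  is on length because the adjacent case applies the hypothesis a second time, to the word just
  obtained.\<close>

lemma red_exchange: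
  assumes "dec n g" "red n g ws h" "1 \<le> i" "i < n" "h i < h (Suc i)"
  shows "\<exists>us. red n g us (h \<circ> tr i) \<and> length ws = Suc (length us) \<and>
           theta_word ws = theta_word (i # us)"
  using assms(2-)
proof (induction "length ws" arbitrary: ws h i rule: less_induct)
  case less
  from less.prems(1) show ?case
  proof cases
    case red_Nil
    then show ?thesis using assms(1) less.prems by (force simp: dec_def)
  next
    case (red_Cons ws' h' j)
    note ws = \<open>ws = j # ws'\<close> and h = \<open>h = h' \<circ> tr j\<close> and r = \<open>red n g ws' h'\<close>
      and j = \<open>1 \<le> j\<close> \<open>j < n\<close> and desc = \<open>h' (Suc j) < h' j\<close>
    have h': "h' = h \<circ> tr j" by (simp add: h)
    consider "i = j" | "Suc i < j \<or> Suc j < i" | "i = Suc j" | "j = Suc i" by linarith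
    then show ?thesis
    proof cases
      case 1
      then show ?thesis using ws r h' by auto
    next
      case 2
      then have "h' i < h' (Suc i)" using less.prems(4) by (auto simp: h' tr_def)
      then obtain us where us: "red n g us (h' \<circ> tr i)" "length ws' = Suc (length us)"
        "theta_word ws' = theta_word (i # us)"
        using less.hyps[of ws' h' i] ws r less.prems by auto
      have "red n g (j # us) (h' \<circ> tr i \<circ> tr j)"
        by (rule red.red_Cons[OF us(1) j]) (use desc 2 in \<open>auto simp: tr_def\<close>)
      moreover have "h' \<circ> tr i \<circ> tr j = h \<circ> tr i"
        using tr_tr_commute[OF 2] by (simp add: h o_assoc[symmetric])
      ultimately have "red n g (j # us) (h \<circ> tr i)" by (simp only:)
      moreover have "theta_word ws = theta_word (i # j # us)"
        using us(3) theta_commute[OF 2] by (simp add: ws fun_eq_iff)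
      ultimately show ?thesis using us(2) by (intro exI[of _ "j # us"]) (simp add: ws)
    next
      case 3
      \<comment> \<open>Here \<open>h\<close> increases strictly on three consecutive positions, so
        both \<open>i\<close> and then \<open>j\<close> can be split off from \<open>ws'\<close>,
        and \<open>j i j\<close> is replaced by \<open>i j i\<close>.\<close>
      have a: "h j < h (Suc j)" "h (Suc j) < h (Suc (Suc j))"
        using desc less.prems(4) by (simp_all add: h 3)
      then have "h' i < h' (Suc i)" by (simp add: h' 3 tr_def)
      then obtain us1 where us1: "red n g us1 (h' \<circ> tr i)" "length ws' = Suc (length us1)"
        "theta_word ws' = theta_word (i # us1)"
        using less.hyps[of ws' h' i] ws r less.prems by auto
      have "(h' \<circ> tr i) j < (h' \<circ> tr i) (Suc j)" using a by (simp add: h' 3 tr_def)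
      then obtain us2 where us2: "red n g us2 (h' \<circ> tr i \<circ> tr j)" "length us1 = Suc (length us2)"
        "theta_word us1 = theta_word (j # us2)"
        using less.hyps[of us1 "h' \<circ> tr i" j] ws us1 j by auto
      let ?h = "h' \<circ> tr i \<circ> tr j"
      have "red n g (i # us2) (?h \<circ> tr i)"
        by (rule red.red_Cons[OF us2(1) less.prems(2,3)]) (use a in \<open>simp add: h' 3 tr_def\<close>)
      from red.red_Cons[OF this j] have "red n g (j # i # us2) (?h \<circ> tr i \<circ> tr j)"
        using a by (simp add: h' 3 tr_def)
      moreover have "?h \<circ> tr i \<circ> tr j = h \<circ> tr i"
      proof -
        have "?h \<circ> tr i \<circ> tr j = h \<circ> (tr j \<circ> tr i \<circ> tr j) \<circ> tr i \<circ> tr j"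
          by (simp add: h' o_assoc)
        also have "\<dots> = h \<circ> tr i"
          unfolding 3 tr_tr_braid by (simp add: o_assoc)
        finally show ?thesis .
      qed
      ultimately have "red n g (j # i # us2) (h \<circ> tr i)" by (simp only:)
      moreover have "theta_word ws = theta_word (i # j # i # us2)"
        using us1(3) us2(3) theta_braid[of j] by (simp add: ws 3 fun_eq_iff)
      ultimately show ?thesis using us1(2) us2(2) by (intro exI[of _ "j # i # us2"]) (simp add: ws)
    next
      case 4
      have a: "h i < h (Suc i)" "h (Suc i) < h (Suc (Suc i))"
        using desc less.prems(4) by (simp_all add: h 4)
      then have "h' i < h' (Suc i)" by (simp add: h' 4 tr_def)
      then obtain us1 where us1: "red n g us1 (h' \<circ> tr i)" "length ws' = Suc (length us1)"
        "theta_word ws' = theta_word (i # us1)"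
        using less.hyps[of ws' h' i] ws r less.prems by auto
      have "(h' \<circ> tr i) j < (h' \<circ> tr i) (Suc j)" using a by (simp add: h' 4 tr_def)
      then obtain us2 where us2: "red n g us2 (h' \<circ> tr i \<circ> tr j)" "length us1 = Suc (length us2)"
        "theta_word us1 = theta_word (j # us2)"
        using less.hyps[of us1 "h' \<circ> tr i" j] ws us1 j by auto
      let ?h = "h' \<circ> tr i \<circ> tr j"
      have "red n g (i # us2) (?h \<circ> tr i)"
        by (rule red.red_Cons[OF us2(1) less.prems(2,3)]) (use a in \<open>simp add: h' 4 tr_def\<close>)
      from red.red_Cons[OF this j] have "red n g (j # i # us2) (?h \<circ> tr i \<circ> tr j)"
        using a by (simp add: h' 4 tr_def)
      moreover have "?h \<circ> tr i \<circ> tr j = h \<circ> tr i"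
      proof -
        have "?h \<circ> tr i \<circ> tr j = h \<circ> (tr j \<circ> tr i \<circ> tr j) \<circ> tr i \<circ> tr j"
          by (simp add: h' o_assoc)
        also have "\<dots> = h \<circ> tr i"
          unfolding 4 tr_tr_braid[symmetric] by (simp add: o_assoc)
        finally show ?thesis .
      qed
      ultimately have "red n g (j # i # us2) (h \<circ> tr i)" by (simp only:)
      moreover have "theta_word ws = theta_word (i # j # i # us2)"
        using us1(3) us2(3) theta_braid[of i] by (simp add: ws 4 fun_eq_iff)
      ultimately show ?thesis using us1(2) us2(2) by (intro exI[of _ "j # i # us2"]) (simp add: ws)
    qed
  qed
qed

text \<open>By exchange, the second word may be assumed to begin with the first letter of the first
  word; then induction compares the tails. A nonempty word cannot end at \<open>g\<close>, since it
  would create an ascent there.\<close>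

lemma red_theta_word_unique:
  assumes "dec n g" "red n g ws h" "red n g vs h"
  shows "theta_word ws = theta_word vs"
  using assms(2,3)
proof (induction arbitrary: vs)
  case red_Nil
  from red_Nil.prems show ?case
  proof cases
    case (red_Cons us h i)
    then have "g i < g (Suc i)" by simp
    then show ?thesis using assms(1) red_Cons by (force simp: dec_def)
  qed simp
next
  case (red_Cons ws h i)
  have "(h \<circ> tr i) i < (h \<circ> tr i) (Suc i)" using red_Cons.hyps by simp
  then obtain us where "red n g us (h \<circ> tr i \<circ> tr i)" "theta_word vs = theta_word (i # us)"
    using red_exchange[OF assms(1) red_Cons.prems red_Cons.hyps(2,3)] by blast
  then show ?case using red_Cons.IH[of us] by (simp add: fun_eq_iff)
qed

text \<open>Vanishing outside the positions 1 to \<open>n\<close> makes these functions correspond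
  exactly to lists of length \<open>n\<close>.\<close>

definition supp :: "nat \<Rightarrow> (nat \<Rightarrow> nat) \<Rightarrow> bool" where
  "supp n g \<longleftrightarrow> (\<forall>j. j < 1 \<or> n < j \<longrightarrow> g j = 0)"

lemma red_supp:
  assumes "red n g ws h" "supp n g"
  shows "supp n h"
  using assms(1)
proof induction
  case (red_Cons ws h i)
  have "tr i j = j" if "j < 1 \<or> n < j" for j
    using that red_Cons.hyps(2,3) by (auto simp: tr_def)
  then show ?case using red_Cons.IH by (simp add: supp_def)
qed (rule assms(2))

section \<open>Operators indexed by permutations\<close>

text \<open>The longest element, extended to an involution of all of \<open>nat\<close>. A word with
  \<open>red n (rho n) ws p\<close> is a reduced word of the permutation \<open>v\<close> with \<open>p = v \<cdot> rho n\<close>, and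
  right multiplication of \<open>v\<close> by \<open>s\<^sub>i\<close> exchanges the values \<open>n - i\<close> and \<open>n - i - 1\<close> of \<open>p\<close>.\<close>

definition rho :: "nat \<Rightarrow> nat \<Rightarrow> nat" where
  "rho n j = (if j \<le> n then n - j else j)"

lemma rho_rho [simp]: "rho n (rho n j) = j"
  by (auto simp: rho_def)

lemma dec_rho: "dec n (rho n)"
  by (auto simp: dec_def rho_def)

lemma tr_rho: "1 \<le> i \<Longrightarrow> i < n \<Longrightarrow> tr (n - Suc i) \<circ> rho n = rho n \<circ> tr i"
proof
  fix j assume "1 \<le> i" "i < n"
  then have "rho n j = n - Suc i \<longleftrightarrow> j = Suc i" "rho n j = Suc (n - Suc i) \<longleftrightarrow> j = i"
    "rho n i = Suc (n - Suc i)" "rho n (Suc i) = n - Suc i"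
    by (auto simp: rho_def)
  then show "(tr (n - Suc i) \<circ> rho n) j = (rho n \<circ> tr i) j"
    by (simp add: tr_def)
qed

lemma red_rho_bij: "red n (rho n) ws p \<Longrightarrow> bij p"
proof (induction rule: red.induct)
  case red_Nil
  show ?case by (rule o_bij[of "rho n"]) (auto simp: fun_eq_iff)
next
  case (red_Cons ws h i)
  have "bij (tr i)" by (rule o_bij[of "tr i"]) auto
  then show ?case by (rule bij_comp[OF _ red_Cons.IH])
qed

lemma red_rho_range:
  assumes "red n (rho n) ws p" "1 \<le> j" "j \<le> n"
  shows "p j < n"
  using assms by (induction arbitrary: j) (auto simp: rho_def tr_def)

text \<open>For bijective \<open>p\<close> this compares the positions of two values, that is,
  values of the inverse of \<open>p\<close>. For \<open>p = v \<cdot> rho n\<close> it tells whether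
  \<open>v s\<^sub>i\<close> is longer or shorter than \<open>v\<close>.\<close>

definition before :: "(nat \<Rightarrow> nat) \<Rightarrow> nat \<Rightarrow> nat \<Rightarrow> bool" where
  "before p c d \<longleftrightarrow> (\<exists>a b. a < b \<and> p a = c \<and> p b = d)"

lemma before_total:
  assumes "bij p" "c \<noteq> d"
  shows "before p c d \<or> before p d c"
proof -
  obtain a b where "p a = c" "p b = d" using bij_is_surj[OF assms(1)] by (metis surjD)
  then show ?thesis using assms(2) unfolding before_def by (cases a b rule: linorder_cases) auto
qed

lemma before_trans:
  assumes "inj p" "before p c d" "before p d e"
  shows "before p c e"
  using assms unfolding before_def by (metis injD less_trans)

lemma before_asym: "inj p \<Longrightarrow> before p c d \<Longrightarrow> \<not> before p d c"
  unfolding before_def by (metis injD less_asym)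

text \<open>An adjacent swap changes the relative order of only the two values it exchanges.\<close>

lemma before_comp_tr:
  assumes "before (q \<circ> tr j) c d" "\<not> (q j = d \<and> q (Suc j) = c)"
  shows "before q c d"
proof -
  obtain a b where ab: "a < b" "q (tr j a) = c" "q (tr j b) = d"
    using assms(1) by (auto simp: before_def)
  have "\<not> (a = j \<and> b = Suc j)" using ab assms(2) by auto
  then have "tr j a < tr j b" using ab(1) by (auto simp: tr_def)
  then show ?thesis using ab by (auto simp: before_def)
qed

text \<open>A new last letter \<open>i\<close> turns the start \<open>rho n\<close> into
  \<open>tr (n - Suc i) \<circ> rho n\<close>. This exchange of two values commutes with all later
  swaps of positions.\<close>

lemma red_right_mult:
  assumes "red n (rho n) ws p" "1 \<le> i" "i < n" "before p (n - i) (n - Suc i)"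
  shows "red n (rho n) (ws @ [i]) (tr (n - Suc i) \<circ> p)"
  using assms(1,4)
proof (induction)
  case red_Nil
  have "red n (rho n) [i] (rho n \<circ> tr i)"
    using assms(2,3) by (intro red.intros) (auto simp: rho_def)
  then show ?case unfolding tr_rho[OF assms(2,3)] append_Nil .
next
  case (red_Cons ws q j)
  let ?c = "n - Suc i"
  have c: "n - i = Suc ?c" using assms by simp
  have "before q (n - i) (n - Suc i)"
    by (rule before_comp_tr[OF red_Cons.prems]) (use \<open>q (Suc j) < q j\<close> c in simp)
  then have r: "red n (rho n) (ws @ [i]) (tr ?c \<circ> q)" by (rule red_Cons.IH)
  \<comment> \<open>Exchanging two consecutive values alters no comparison except the one between
    these two values themselves.\<close>
  have "\<not> (q j = Suc ?c \<and> q (Suc j) = ?c)"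
  proof
    assume q: "q j = Suc ?c \<and> q (Suc j) = ?c"
    obtain a b where ab: "a < b" "q (tr j a) = Suc ?c" "q (tr j b) = ?c"
      using red_Cons.prems by (auto simp: before_def c)
    then have "q (tr j a) = q j" "q (tr j b) = q (Suc j)" using q by simp_all
    then have "tr j a = j" "tr j b = Suc j"
      using bij_is_inj[OF red_rho_bij[OF red_Cons.hyps(1)]] by (auto dest: injD)
    then have "a = Suc j" "b = j" by (metis tr_left tr_right tr_tr)+
    then show False using ab by simp
  qed
  then have "(tr ?c \<circ> q) (Suc j) < (tr ?c \<circ> q) j"
    using \<open>q (Suc j) < q j\<close> by (auto simp: tr_def)
  from red.red_Cons[OF r \<open>1 \<le> j\<close> \<open>j < n\<close> this] show ?case
    by (simp only: o_assoc append_Cons)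
qed

text \<open>The values \<open>n - i\<close> and \<open>n - Suc i\<close> start in the opposite
  order, so some letter of the word crosses them. At that letter the word can be rewritten to end in
  \<open>i\<close>.\<close>

lemma red_right_descent:
  assumes "red n (rho n) ws p" "1 \<le> i" "i < n" "before p (n - Suc i) (n - i)"
  shows "\<exists>vs. theta_word ws = theta_word (vs @ [i])"
  using assms(1,4)
proof (induction)
  case red_Nil
  then show ?case using assms by (auto simp: before_def rho_def split: if_splits)
next
  case (red_Cons ws q j)
  let ?c = "n - Suc i"
  have c: "n - i = Suc ?c" using assms by simp
  show ?case
  proof (cases "q j = Suc ?c \<and> q (Suc j) = ?c")
    case True
    then have "before q (n - i) (n - Suc i)" unfolding c before_def by blast
    from red_right_mult[OF red_Cons.hyps(1) assms(2,3) this]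
    have "red n (rho n) (ws @ [i]) (tr ?c \<circ> q)" .
    \<comment> \<open>The two values sit at the positions \<open>j\<close> and \<open>Suc j\<close>,
      so exchanging the values is exchanging the positions.\<close>
    moreover have "tr ?c \<circ> q = q \<circ> tr j"
    proof
      fix x
      have "q x = q j \<longleftrightarrow> x = j" "q x = q (Suc j) \<longleftrightarrow> x = Suc j"
        using bij_is_inj[OF red_rho_bij[OF red_Cons.hyps(1)]] by (auto dest: injD)
      then show "(tr ?c \<circ> q) x = (q \<circ> tr j) x" using True by (auto simp: tr_def)
    qed
    ultimately have "red n (rho n) (ws @ [i]) (q \<circ> tr j)" by simp
    then show ?thesis
      using red_theta_word_unique[OF dec_rho] red.red_Cons[OF red_Cons.hyps] by blast
  next
    case False
    then have "before q (n - Suc i) (n - i)"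
      using before_comp_tr[OF red_Cons.prems] unfolding c by blast
    then obtain vs where "theta_word ws = theta_word (vs @ [i])" using red_Cons.IH by blast
    then have "theta_word (j # ws) = theta_word ((j # vs) @ [i])" by (simp add: fun_eq_iff)
    then show ?thesis by blast
  qed
qed

section \<open>Atoms and key polynomials\<close>

definition mon :: "nat \<Rightarrow> (nat \<Rightarrow> nat) \<Rightarrow> poly" where
  "mon n g = (\<Prod>j=1..n. var j ^ g j)"

lemma mon_add: "mon n (\<lambda>j. g j + h j) = mon n g * mon n h"
  by (simp add: mon_def power_add prod.distrib)

lemma s_poly_mon:
  assumes "1 \<le> i" "i < n"
  shows "s_poly i (mon n g) = mon n (g \<circ> tr i)"
proof -
  have "s_poly i (mon n g) = (\<Prod>j=1..n. var (tr i j) ^ g j)"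
    by (simp add: mon_def s_poly_prod)
  also have "\<dots> = (\<Prod>j=1..n. var j ^ g (tr i j))"
    using tr_range[OF assms] by (intro prod.reindex_bij_witness[of _ "tr i" "tr i"]) auto
  finally show ?thesis by (simp add: mon_def)
qed

lemma s_poly_mon_eq:
  assumes "1 \<le> i" "i < n" "g i = g (Suc i)"
  shows "s_poly i (mon n g) = mon n g"
proof -
  have "g \<circ> tr i = g" using assms(3) by (auto simp: fun_eq_iff tr_def)
  then show ?thesis using s_poly_mon[OF assms(1,2)] by simp
qed

text \<open>Exponents of a squarefree monomial; \<open>mon n (chi {1..k})\<close> is the product
  \<open>E\<^sub>k\<close>.\<close>

definition chi :: "nat set \<Rightarrow> nat \<Rightarrow> nat" where
  "chi J j = (if j \<in> J then 1 else 0)"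

lemma mon_chi_insert:
  assumes "1 \<le> i" "i \<le> n" "i \<notin> J"
  shows "mon n (chi (insert i J)) = var i * mon n (chi J)"
proof -
  have "mon n (chi {i}) = (\<Prod>j=1..n. if j = i then var j else 1)"
    unfolding mon_def by (intro prod.cong) (auto simp: chi_def)
  also have "\<dots> = var i" using assms by (simp add: prod.delta)
  finally have "mon n (chi {i}) = var i" .
  moreover have "chi (insert i J) = (\<lambda>j. chi {i} j + chi J j)"
    using assms(3) by (auto simp: chi_def fun_eq_iff)
  ultimately show ?thesis by (simp add: mon_add)
qed

text \<open>This is \<open>x\<^sub>i \<theta>\<^sub>i = \<pi>\<^sub>i
  x\<^sub>i\<^sub>+\<^sub>1\<close> times the remaining factor, which is symmetric because it
  contains neither of the two variables.\<close>

lemma mon_chi_mult_theta: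
  assumes "1 \<le> i" "i < n" "i \<in> J" "Suc i \<notin> J"
  defines "X \<equiv> mon n (chi (insert (Suc i) (J - {i})))"
  shows "mon n (chi J) * theta i f = X * f + theta i (X * f)"
proof -
  let ?Y = "mon n (chi (J - {i}))"
  have Y: "s_poly i ?Y = ?Y"
    using assms by (intro s_poly_mon_eq) (auto simp: chi_def)
  have X: "X * f = ?Y * (var (Suc i) * f)"
    using assms by (simp add: X_def mon_chi_insert algebra_simps)
  have "mon n (chi J) = var i * ?Y"
    using mon_chi_insert[of i n "J - {i}"] assms by (simp add: insert_absorb)
  then have "mon n (chi J) * theta i f = ?Y * (var i * theta i f)"
    by (simp add: algebra_simps)
  also have "\<dots> = X * f + theta i (X * f)"
    unfolding X theta_sym_mult[OF Y] var_mult_theta by (simp add: distrib_left)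
  finally show ?thesis .
qed

text \<open>The atoms without lists and without a chosen word; the last section identifies them with
  \<open>atom\<close>.\<close>

definition is_atom :: "nat \<Rightarrow> poly \<Rightarrow> bool" where
  "is_atom n f \<longleftrightarrow> (\<exists>g ws h. dec n g \<and> supp n g \<and> red n g ws h \<and> f = theta_word ws (mon n g))"

inductive_set atom_cone :: "nat \<Rightarrow> poly set" for n where
  zero: "0 \<in> atom_cone n"
| atom: "is_atom n f \<Longrightarrow> f \<in> atom_cone n"
| add: "f \<in> atom_cone n \<Longrightarrow> g \<in> atom_cone n \<Longrightarrow> f + g \<in> atom_cone n"

text \<open>Words in the \<open>\<pi>\<^sub>i\<close> may be arbitrary here, since
  \<open>\<theta>\<^sub>v\<close> absorbs the factors \<open>\<pi>\<^sub>i\<close> one at a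
  time.\<close>

inductive_set key_poly :: "nat \<Rightarrow> poly set" for n where
  mon: "dec n g \<Longrightarrow> supp n g \<Longrightarrow> mon n g \<in> key_poly n"
| step: "f \<in> key_poly n \<Longrightarrow> 1 \<le> i \<Longrightarrow> i < n \<Longrightarrow> f + theta i f \<in> key_poly n"

text \<open>The last assumption says that the permutation \<open>v\<close> with
  \<open>p = v \<cdot> rho n\<close> is a minimal coset representative for the stabilizer of
  \<open>g\<close>. A reduced word of such a \<open>v\<close> never swaps equal entries of
  \<open>g\<close>, so it stays reduced on the orbit of \<open>g\<close>.\<close>

lemma red_transport:
  assumes "dec n g" "red n (rho n) ws p"
    and "\<And>i. 1 \<le> i \<Longrightarrow> i < n \<Longrightarrow> g i = g (Suc i) \<Longrightarrow> before p (n - i) (n - Suc i)"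
  shows "red n g ws (g \<circ> rho n \<circ> p)"
  using assms(2,3)
proof (induction)
  case red_Nil
  have "g \<circ> rho n \<circ> rho n = g" by (simp add: fun_eq_iff)
  then show ?case by (simp only: red.red_Nil)
next
  case (red_Cons ws q j)
  have inj: "inj (q \<circ> tr j)"
    using red_rho_bij[OF red.red_Cons[OF red_Cons.hyps]] by (rule bij_is_inj)
  have "before q (n - i) (n - Suc i)" if "1 \<le> i" "i < n" "g i = g (Suc i)" for i
    by (rule before_comp_tr[OF red_Cons.prems[OF that]]) (use that \<open>q (Suc j) < q j\<close> in linarith)
  then have r: "red n g ws (g \<circ> rho n \<circ> q)" by (rule red_Cons.IH)
  \<comment> \<open>These are the original positions in \<open>g\<close> of the two entries being
    swapped.\<close>
  define u v where "u = rho n (q j)" and "v = rho n (q (Suc j))"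
  have "q j < n" "q (Suc j) < n"
    using red_rho_range[OF red_Cons.hyps(1)] \<open>1 \<le> j\<close> \<open>j < n\<close> by simp_all
  then have uv: "1 \<le> u" "u < v" "v \<le> n" "q j = n - u" "q (Suc j) = n - v"
    using \<open>q (Suc j) < q j\<close> by (auto simp: u_def v_def rho_def)
  have "g v < g u"
  proof (rule ccontr)
    assume "\<not> g v < g u"
    then have le: "g u \<le> g v" by simp
    \<comment> \<open>If the two entries were equal, \<open>g\<close> would be constant from
      \<open>u\<close> to \<open>v\<close>. The assumption on neighbours then chains up and
      contradicts the swap.\<close>
    have "before (q \<circ> tr j) (n - u) (n - w)" if "Suc u \<le> w" "w \<le> v" for w
      using that
    proof (induction w rule: dec_induct)
      case base
      have "g (Suc u) \<le> g u" "g v \<le> g (Suc u)"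
        using uv by (auto intro!: dec_antimono[OF assms(1)])
      then show ?case using red_Cons.prems[of u] uv le by simp
    next
      case (step w)
      have "g w \<le> g u" "g (Suc w) \<le> g w" "g v \<le> g (Suc w)"
        using uv step by (auto intro!: dec_antimono[OF assms(1)])
      then have "g w = g (Suc w)" using le by simp
      then have "before (q \<circ> tr j) (n - w) (n - Suc w)"
        using uv step.hyps step.prems red_Cons.prems[of w] by linarith
      moreover have "before (q \<circ> tr j) (n - u) (n - w)"
        using step.IH step.prems Suc_leD by blast
      ultimately show ?case using before_trans[OF inj] by blast
    qed
    then have "before (q \<circ> tr j) (n - u) (n - v)" using uv by simp
    moreover have "before (q \<circ> tr j) (n - v) (n - u)"
      unfolding before_def using uv by (intro exI[of _ j] exI[of _ "Suc j"]) simp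
    ultimately show False using before_asym[OF inj] by blast
  qed
  then have "(g \<circ> rho n \<circ> q) (Suc j) < (g \<circ> rho n \<circ> q) j" by (simp add: u_def v_def)
  from red.red_Cons[OF r \<open>1 \<le> j\<close> \<open>j < n\<close> this] show ?case
    by (simp only: o_assoc)
qed

text \<open>Either \<open>v\<close> is a minimal coset representative and the result is an atom, or
  \<open>v\<close> has a right descent \<open>i\<close> fixing \<open>g\<close>, and
  \<open>\<theta>\<^sub>i\<close> annihilates the monomial.\<close>

lemma theta_word_mon_in_atom_cone:
  assumes "dec n g" "supp n g" "red n (rho n) ws p"
  shows "theta_word ws (mon n g) \<in> atom_cone n"
proof (cases "\<forall>i. 1 \<le> i \<and> i < n \<and> g i = g (Suc i) \<longrightarrow> before p (n - i) (n - Suc i)")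
  case True
  then have "red n g ws (g \<circ> rho n \<circ> p)" using red_transport[OF assms(1,3)] by blast
  then have "is_atom n (theta_word ws (mon n g))" using assms unfolding is_atom_def by blast
  then show ?thesis by (rule atom_cone.atom)
next
  case False
  then obtain i where i: "1 \<le> i" "i < n" "g i = g (Suc i)" "\<not> before p (n - i) (n - Suc i)" by blast
  then have "before p (n - Suc i) (n - i)"
    using before_total[OF red_rho_bij[OF assms(3)], of "n - i" "n - Suc i"] by auto
  then obtain vs where "theta_word ws = theta_word (vs @ [i])"
    using red_right_descent[OF assms(3) i(1,2)] by blast
  then have "theta_word ws (mon n g) = 0"
    using i by (simp add: theta_word_append theta_sym s_poly_mon_eq)
  then show ?thesis by (simp add: atom_cone.zero)
qed

lemma theta_word_key_poly_in_atom_cone: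
  assumes "f \<in> key_poly n" "red n (rho n) ws p"
  shows "theta_word ws f \<in> atom_cone n"
  using assms
proof (induction arbitrary: ws p)
  case (mon g)
  then show ?case by (rule theta_word_mon_in_atom_cone)
next
  case (step f i)
  show ?case
  proof (cases "before p (n - i) (n - Suc i)")
    case True
    have "theta_word (ws @ [i]) f \<in> atom_cone n"
      by (rule step.IH[OF red_right_mult[OF step.prems step.hyps(2,3) True]])
    then show ?thesis
      using atom_cone.add[OF step.IH[OF step.prems]]
      by (simp add: theta_word_append theta_word_add)
  next
    case False
    then have "before p (n - Suc i) (n - i)"
      using before_total[OF red_rho_bij[OF step.prems], of "n - i" "n - Suc i"] step.hyps by auto
    then obtain vs where "theta_word ws = theta_word (vs @ [i])"
      using red_right_descent[OF step.prems step.hyps(2,3)] by blast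
    then have "theta_word ws (f + theta i f) = 0"
      by (simp add: theta_word_append theta_add theta_theta)
    then show ?thesis by (simp add: atom_cone.zero)
  qed
qed

section \<open>Multiplication by dominant monomials\<close>

text \<open>The identity \<open>x\<^sub>i \<theta>\<^sub>i = \<pi>\<^sub>i x\<^sub>i\<^sub>+\<^sub>1\<close> applies at every step because the invariant on \<open>J\<close> and
  \<open>h\<close> forces each ascent \<open>i\<close> of \<open>h\<close> to satisfy \<open>i \<in> J\<close> and \<open>i + 1 \<notin> J\<close>.\<close>

lemma mon_chi_mult_atom_key_poly:
  assumes "dec n g" "supp n g" "red n g ws h" "J \<subseteq> {1..n}"
    and "\<And>p q. 1 \<le> p \<Longrightarrow> p < q \<Longrightarrow> q \<le> n \<Longrightarrow>
      p \<in> J \<and> q \<notin> J \<or> h q \<le> h p \<and> (p \<notin> J \<and> q \<in> J \<longrightarrow> h q < h p)"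
  shows "mon n (chi J) * theta_word ws (mon n g) \<in> key_poly n"
  using assms(3-5)
proof (induction arbitrary: J)
  case red_Nil
  have "dec n (\<lambda>j. chi J j + g j)"
    unfolding dec_def
  proof (intro allI impI)
    fix i assume i: "1 \<le> i \<and> i < n"
    \<comment> \<open>The extra 1 can break monotonicity only if it falls on \<open>Suc i\<close>
      but not on \<open>i\<close>; there the invariant provides a strict drop of
      \<open>g\<close>.\<close>
    then show "chi J (Suc i) + g (Suc i) \<le> chi J i + g i"
      using red_Nil.prems(2)[of i "Suc i"] assms(1) by (auto simp: chi_def dec_def)
  qed
  moreover have "supp n (\<lambda>j. chi J j + g j)"
    using red_Nil.prems(1) assms(2) by (auto simp: chi_def supp_def)
  ultimately show ?case by (simp add: mon_add[symmetric] key_poly.mon)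
next
  case (red_Cons ws h i)
  note i = \<open>1 \<le> i\<close> \<open>i < n\<close>
  have J: "i \<in> J" "Suc i \<notin> J"
    using red_Cons.prems(2)[of i "Suc i"] red_Cons.hyps by auto
  define J' where "J' = insert (Suc i) (J - {i})"
  have J': "q \<in> J' \<longleftrightarrow> tr i q \<in> J" for q
    using J by (auto simp: J'_def tr_def)
  have "mon n (chi J') * theta_word ws (mon n g) \<in> key_poly n"
  proof (rule red_Cons.IH)
    show "J' \<subseteq> {1..n}" using red_Cons.prems(1) i by (auto simp: J'_def)
    fix p q assume pq: "1 \<le> p" "p < q" "q \<le> n"
    show "p \<in> J' \<and> q \<notin> J' \<or> h q \<le> h p \<and> (p \<notin> J' \<and> q \<in> J' \<longrightarrow> h q < h p)"
    proof (cases "p = i \<and> q = Suc i")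
      case True
      \<comment> \<open>The swap puts this pair in the unfavourable order, which the strict descent
        of \<open>h\<close> at \<open>i\<close> permits.\<close>
      then show ?thesis using J red_Cons.hyps by (auto simp: J')
    next
      case False
      then have "tr i p < tr i q" using pq by (auto simp: tr_def)
      moreover have "1 \<le> tr i p" "tr i q \<le> n"
        using tr_range[OF i, of p] tr_range[OF i, of q] pq by auto
      ultimately show ?thesis
        using red_Cons.prems(2)[of "tr i p" "tr i q"] by (simp add: J')
    qed
  qed
  then show ?case
    using mon_chi_mult_theta[OF i J] key_poly.step[OF _ i] by (simp add: J'_def)
qed

text \<open>Ascents \<open>i \<noteq> k\<close> of \<open>h\<close> are stripped off one by one, as
  their \<open>\<theta>\<^sub>i\<close> commutes with \<open>E\<^sub>k\<close>. The last conjunct,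
  that \<open>p\<close> and \<open>h\<close> agree on order inside the blocks up to \<open>k\<close>
  and beyond \<open>k\<close>, keeps the collected word \<open>vs\<close> reduced; ties of
  \<open>h\<close> count as decreasing in \<open>p\<close>.\<close>

lemma mon_initial_mult_atom:
  assumes "dec n g" "supp n g" "red n g ws h" "k \<le> n"
  shows "\<exists>vs p f. f \<in> key_poly n \<and> red n (rho n) vs p \<and>
      mon n (chi {1..k}) * theta_word ws (mon n g) = theta_word vs f \<and>
      (\<forall>a b. 1 \<le> a \<and> a < b \<and> b \<le> n \<and> (b \<le> k \<or> k < a) \<longrightarrow> (p a < p b \<longleftrightarrow> h a < h b))"
  using assms(3)
proof (induction "length ws" arbitrary: ws h rule: less_induct)
  case less
  show ?case
  proof (cases "\<exists>i. 1 \<le> i \<and> i < n \<and> i \<noteq> k \<and> h i < h (Suc i)")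
    case True
    then obtain i where i: "1 \<le> i" "i < n" and ik: "i \<noteq> k" and h: "h i < h (Suc i)" by blast
    obtain us where us: "red n g us (h \<circ> tr i)" "length ws = Suc (length us)"
      "theta_word ws = theta_word (i # us)"
      using red_exchange[OF assms(1) less.prems i h] by blast
    have len: "length us < length ws" using us(2) by simp
    obtain vs p f where f: "f \<in> key_poly n" and p: "red n (rho n) vs p"
      and eq: "mon n (chi {1..k}) * theta_word us (mon n g) = theta_word vs f"
      and ord: "\<forall>a b. 1 \<le> a \<and> a < b \<and> b \<le> n \<and> (b \<le> k \<or> k < a) \<longrightarrow>
        (p a < p b \<longleftrightarrow> (h \<circ> tr i) a < (h \<circ> tr i) b)"
      using less.hyps[OF len us(1)] by (elim exE conjE) (rule that)
    have inj: "inj p" using red_rho_bij[OF p] by (rule bij_is_inj)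
    \<comment> \<open>Both positions lie in the same block, so \<open>p\<close> inherits the descent
      of \<open>h \<circ> tr i\<close> at \<open>i\<close>.\<close>
    have "Suc i \<le> k \<or> k < i" using ik by linarith
    then have "\<not> p i < p (Suc i)" using ord[rule_format, of i "Suc i"] i h by simp
    moreover have "p i \<noteq> p (Suc i)" using injD[OF inj, of i "Suc i"] by auto
    ultimately have pi: "p (Suc i) < p i" by simp
    have "s_poly i (mon n (chi {1..k})) = mon n (chi {1..k})"
      by (rule s_poly_mon_eq[OF i]) (use i ik in \<open>simp add: chi_def\<close>)
    from theta_sym_mult[OF this]
    have "mon n (chi {1..k}) * theta_word ws (mon n g) = theta_word (i # vs) f"
      by (simp only: us(3) theta_word_Cons eq[symmetric])
    moreover have "(p \<circ> tr i) a < (p \<circ> tr i) b \<longleftrightarrow> h a < h b"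
      if ab: "1 \<le> a" "a < b" "b \<le> n" "b \<le> k \<or> k < a" for a b
    proof (cases "a = i \<and> b = Suc i")
      case True
      then show ?thesis using pi h by simp
    next
      case False
      have "tr i a < tr i b" using False ab(2) by (auto simp: tr_def)
      moreover have "1 \<le> tr i a" "tr i b \<le> n"
        using tr_range[OF i, of a] tr_range[OF i, of b] ab by auto
      moreover have "tr i b \<le> k \<or> k < tr i a" using ab(2,4) ik by (auto simp: tr_def)
      ultimately show ?thesis using ord[rule_format, of "tr i a" "tr i b"] by simp
    qed
    ultimately show ?thesis
      using f red.red_Cons[OF p i pi]
      by (intro exI[of _ "i # vs"] exI[of _ "p \<circ> tr i"] exI[of _ f] conjI allI impI) (assumption | blast)+
  next
    case False
    then have desc: "h (Suc i) \<le> h i" if "1 \<le> i" "i < n" "i \<noteq> k" for i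
      using that not_less by blast
    have le: "h b \<le> h a" if ab: "1 \<le> a" "a < b" "b \<le> n" "b \<le> k \<or> k < a" for a b
      using ab(4)
    proof
      assume "b \<le> k"
      show ?thesis
        by (rule dec_on_antimono[of 1 k h, OF desc]) (use \<open>b \<le> k\<close> ab assms(4) in simp_all)
    next
      assume "k < a"
      show ?thesis
        by (rule dec_on_antimono[of "Suc k" n h, OF desc]) (use \<open>k < a\<close> ab in simp_all)
    qed
    \<comment> \<open>Now \<open>h\<close> decreases weakly on both blocks, which is the invariant
      for \<open>J = {1..k}\<close>.\<close>
    have "mon n (chi {1..k}) * theta_word ws (mon n g) \<in> key_poly n"
    proof (rule mon_chi_mult_atom_key_poly[OF assms(1,2) less.prems])
      fix p q assume "1 \<le> p" "p < q" "q \<le> n"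
      then show "p \<in> {1..k} \<and> q \<notin> {1..k} \<or>
          h q \<le> h p \<and> (p \<notin> {1..k} \<and> q \<in> {1..k} \<longrightarrow> h q < h p)"
        using le[of p q] by (cases "q \<le> k \<or> k < p") auto
    qed (use assms(4) in auto)
    moreover have "rho n a < rho n b \<longleftrightarrow> h a < h b"
      if "1 \<le> a" "a < b" "b \<le> n" "b \<le> k \<or> k < a" for a b
      using le[OF that] that by (auto simp: rho_def)
    ultimately show ?thesis
      using red.red_Nil[of n "rho n"]
      by (intro exI[of _ "[]"] exI[of _ "rho n"]
          exI[of _ "mon n (chi {1..k}) * theta_word ws (mon n g)"] conjI allI impI)
        (assumption | simp only: theta_word_Nil | blast)+
  qed
qed

lemma mon_initial_mult_atom_cone:
  assumes "f \<in> atom_cone n" "k \<le> n"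
  shows "mon n (chi {1..k}) * f \<in> atom_cone n"
  using assms(1)
proof induction
  case (atom f)
  then obtain g ws h where "dec n g" "supp n g" "red n g ws h" "f = theta_word ws (mon n g)"
    by (auto simp: is_atom_def)
  then show ?case
    using mon_initial_mult_atom[of n g ws h k] assms(2)
    by (auto dest: theta_word_key_poly_in_atom_cone simp del: theta_word_Cons)
qed (simp_all add: atom_cone.zero atom_cone.add distrib_left)

text \<open>The monomial is built from the columns of the partition: the last part \<open>e\<close>
  gives \<open>e\<close> columns of height \<open>Suc m\<close>, and removing them leaves at most
  \<open>m\<close> nonzero parts.\<close>

lemma dec_mon_mult_atom_cone:
  assumes "dec n g" "m \<le> n" "\<And>j. m < j \<Longrightarrow> g j = 0" "f \<in> atom_cone n"
  shows "mon n g * f \<in> atom_cone n"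
  using assms
proof (induction m arbitrary: g)
  case 0
  then have "mon n g = 1" by (simp add: mon_def)
  then show ?case using 0 by simp
next
  case (Suc m)
  let ?E = "mon n (chi {1..Suc m})"
  define e where "e = g (Suc m)"
  define g' where "g' j = (if j \<le> Suc m then g j - e else 0)" for j
  have ge: "e \<le> g j" if "1 \<le> j" "j \<le> Suc m" for j
    unfolding e_def using that Suc.prems by (intro dec_antimono[of n g]) auto
  have "dec n g'" using Suc.prems(1) by (auto simp: dec_def g'_def intro: diff_le_mono)
  then have "mon n g' * f \<in> atom_cone n"
  proof (rule Suc.IH)
    show "g' j = 0" if "m < j" for j
      using that by (cases "j = Suc m") (simp_all add: g'_def e_def)
  qed (use Suc.prems in simp_all)
  then have "?E ^ d * (mon n g' * f) \<in> atom_cone n" for d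
    by (induction d) (use mon_initial_mult_atom_cone[OF _ Suc.prems(2)] in \<open>auto simp: mult.assoc\<close>)
  moreover have "mon n g = ?E ^ e * mon n g'"
  proof -
    have "?E ^ e = mon n (\<lambda>j. e * chi {1..Suc m} j)"
      unfolding mon_def prod_power_distrib by (simp add: power_mult[symmetric] mult.commute)
    moreover have "mon n g = mon n (\<lambda>j. e * chi {1..Suc m} j + g' j)"
      unfolding mon_def using ge Suc.prems(3)
      by (intro prod.cong) (auto simp: chi_def g'_def)
    ultimately show ?thesis by (simp add: mon_add)
  qed
  ultimately show ?case by (simp add: mult.assoc)
qed

section \<open>Atoms of lists\<close>

definition list_fun :: "nat list \<Rightarrow> nat \<Rightarrow> nat" where
  "list_fun \<gamma> j = (if 1 \<le> j \<and> j \<le> length \<gamma> then \<gamma> ! (j - 1) else 0)"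

lemma supp_list_fun: "supp (length \<gamma>) (list_fun \<gamma>)"
  by (auto simp: supp_def list_fun_def)

lemma list_fun_inject:
  assumes "length \<gamma> = length \<delta>" "list_fun \<gamma> = list_fun \<delta>"
  shows "\<gamma> = \<delta>"
proof (rule nth_equalityI[OF assms(1)])
  fix j assume "j < length \<gamma>"
  then show "\<gamma> ! j = \<delta> ! j"
    using fun_cong[OF assms(2), of "Suc j"] assms(1) by (simp add: list_fun_def)
qed

lemma supp_imp_list_fun:
  assumes "supp n g"
  shows "\<exists>\<gamma>. length \<gamma> = n \<and> list_fun \<gamma> = g"
proof (intro exI conjI)
  let ?\<gamma> = "map (\<lambda>j. g (Suc j)) [0..<n]"
  show "length ?\<gamma> = n" by simp
  show "list_fun ?\<gamma> = g"
  proof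
    fix j
    show "list_fun ?\<gamma> j = g j"
    proof (cases "1 \<le> j \<and> j \<le> n")
      case True
      then obtain i where "j = Suc i" "i < n" by (cases j) auto
      then show ?thesis by (simp add: list_fun_def)
    next
      case False
      then have "j < 1 \<or> n < j" by linarith
      then have "g j = 0" by (rule assms[unfolded supp_def, rule_format])
      moreover have "list_fun ?\<gamma> j = 0"
        unfolding list_fun_def \<open>length ?\<gamma> = n\<close> using False by (rule if_not_P)
      ultimately show ?thesis by simp
    qed
  qed
qed

lemma xpow_eq_mon: "xpow \<gamma> = mon (length \<gamma>) (list_fun \<gamma>)"
proof -
  have "mon (length \<gamma>) (list_fun \<gamma>) = (\<Prod>j<length \<gamma>. var (Suc j) ^ list_fun \<gamma> (Suc j))"
    unfolding mon_def One_nat_def by (rule prod.atLeast1_atMost_eq)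
  then show ?thesis by (simp add: xpow_def list_fun_def)
qed

lemma dec_list_fun_iff: "dec (length \<gamma>) (list_fun \<gamma>) \<longleftrightarrow> sorted_wrt (\<ge>) \<gamma>"
proof
  assume d: "dec (length \<gamma>) (list_fun \<gamma>)"
  show "sorted_wrt (\<ge>) \<gamma>"
    unfolding sorted_wrt_iff_nth_less
  proof (intro allI impI)
    fix i j assume "i < j" "j < length \<gamma>"
    then show "\<gamma> ! j \<le> \<gamma> ! i"
      using dec_antimono[OF d, of "Suc i" "Suc j"] by (simp add: list_fun_def)
  qed
next
  assume "sorted_wrt (\<ge>) \<gamma>"
  then have s: "\<gamma> ! j \<le> \<gamma> ! i" if "i < j" "j < length \<gamma>" for i j
    using that by (simp add: sorted_wrt_iff_nth_less)
  show "dec (length \<gamma>) (list_fun \<gamma>)"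
    unfolding dec_def
  proof (intro allI impI)
    fix i assume "1 \<le> i \<and> i < length \<gamma>"
    then show "list_fun \<gamma> (Suc i) \<le> list_fun \<gamma> i"
      using s[of "i - 1" i] by (simp add: list_fun_def)
  qed
qed

section \<open>Words acting on lists\<close>

lemma length_s_comp [simp]: "length (s_comp i \<gamma>) = length \<gamma>"
  by (simp add: s_comp_def)

lemma mset_s_comp [simp]: "mset (s_comp i \<gamma>) = mset \<gamma>"
proof (cases "1 \<le> i \<and> i < length \<gamma>")
  case True
  then have "i < length \<gamma>" "i - 1 < length \<gamma>" by linarith+
  from mset_swap[OF this] show ?thesis using True by (simp add: s_comp_def)
qed (auto simp: s_comp_def)

lemma list_fun_s_comp:
  assumes "1 \<le> i" "i < length \<gamma>"
  shows "list_fun (s_comp i \<gamma>) = list_fun \<gamma> \<circ> tr i"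
proof
  fix j
  consider "j = i" | "j = Suc i" | "j = 0" | "1 \<le> j" "j \<noteq> i" "j \<noteq> Suc i" by linarith
  then show "list_fun (s_comp i \<gamma>) j = (list_fun \<gamma> \<circ> tr i) j"
    using assms by cases (simp_all add: list_fun_def s_comp_def tr_def nth_list_update)
qed

lemma word_act_Nil [simp]: "word_act [] \<gamma> = \<gamma>"
  and word_act_Cons [simp]: "word_act (i # ws) \<gamma> = s_comp i (word_act ws \<gamma>)"
  by (simp_all add: word_act_def)

lemma length_word_act [simp]: "length (word_act ws \<gamma>) = length \<gamma>"
  by (induction ws) simp_all

lemma mset_word_act [simp]: "mset (word_act ws \<gamma>) = mset \<gamma>"
  by (induction ws) simp_all

lemma length_sort_dec [simp]: "length (sort_dec \<gamma>) = length \<gamma>"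
  by (simp add: sort_dec_def)

lemma sorted_sort_dec: "sorted_wrt (\<ge>) (sort_dec \<gamma>)"
  by (simp add: sort_dec_def sorted_wrt_rev)

lemma sort_dec_eqI:
  assumes "mset \<delta> = mset \<gamma>" "sorted_wrt (\<ge>) \<delta>"
  shows "sort_dec \<gamma> = \<delta>"
proof -
  have "sort \<gamma> = rev \<delta>"
    using assms by (intro properties_for_sort) (simp_all add: sorted_wrt_rev)
  then show ?thesis by (simp add: sort_dec_def)
qed

lemma red_word_act:
  assumes "red (length \<gamma>) (list_fun \<gamma>) ws h"
  shows "h = list_fun (word_act ws \<gamma>) \<and> (\<forall>i\<in>set ws. 1 \<le> i)"
  using assms
proof induction
  case (red_Cons ws h i)
  then show ?case using list_fun_s_comp[of i "word_act ws \<gamma>"] by simp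
qed simp

text \<open>Bubble sort: swapping an ascent strictly lowers the sum of the entries weighted by
  position.\<close>

lemma word_to_sort_dec_exists:
  "\<exists>ws. (\<forall>i\<in>set ws. 1 \<le> i) \<and> word_act ws (sort_dec \<gamma>) = \<gamma>"
proof (induction "\<Sum>j\<in>{1..length \<gamma>}. j * list_fun \<gamma> j" arbitrary: \<gamma> rule: less_induct)
  case less
  show ?case
  proof (cases "dec (length \<gamma>) (list_fun \<gamma>)")
    case True
    then have "sort_dec \<gamma> = \<gamma>" by (intro sort_dec_eqI) (simp_all add: dec_list_fun_iff)
    then show ?thesis by (intro exI[of _ "[]"]) simp
  next
    case False
    then obtain i where i: "1 \<le> i" "i < length \<gamma>" and lt: "list_fun \<gamma> i < list_fun \<gamma> (Suc i)"
      by (auto simp: dec_def not_le)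
    let ?h = "list_fun \<gamma>" and ?I = "{1..length \<gamma>}"
    have split: "(\<Sum>j\<in>?I. j * f j) = i * f i + Suc i * f (Suc i) + (\<Sum>j\<in>?I - {i} - {Suc i}. j * f j)"
      for f :: "nat \<Rightarrow> nat"
      using i by (subst sum.remove[of _ i], simp, simp, subst sum.remove[of _ "Suc i"]) auto
    have "(\<Sum>j\<in>?I - {i} - {Suc i}. j * (?h \<circ> tr i) j) = (\<Sum>j\<in>?I - {i} - {Suc i}. j * ?h j)"
      by (intro sum.cong) (auto simp: tr_def)
    then have "(\<Sum>j\<in>?I. j * (?h \<circ> tr i) j) < (\<Sum>j\<in>?I. j * ?h j)"
      unfolding split[of "?h \<circ> tr i"] split[of ?h] using lt by simp
    then have "(\<Sum>j\<in>{1..length (s_comp i \<gamma>)}. j * list_fun (s_comp i \<gamma>) j) < (\<Sum>j\<in>?I. j * ?h j)"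
      by (simp only: list_fun_s_comp[OF i] length_s_comp)
    from less[OF this] obtain ws where ws: "\<forall>i\<in>set ws. 1 \<le> i"
      "word_act ws (sort_dec (s_comp i \<gamma>)) = s_comp i \<gamma>" by blast
    have "sort_dec (s_comp i \<gamma>) = sort_dec \<gamma>"
      by (intro sort_dec_eqI) (simp_all add: sorted_sort_dec, simp add: sort_dec_def)
    moreover have "s_comp i (s_comp i \<gamma>) = \<gamma>"
      using i by (intro list_fun_inject) (simp_all add: list_fun_s_comp)
    ultimately show ?thesis using ws i by (intro exI[of _ "i # ws"]) simp
  qed
qed

text \<open>In a minimal word a swap of equal entries could be dropped, and a swap of an ascent
  would, by exchange, give a word shorter by two. Only strict descents remain.\<close>

lemma minimal_word_red:
  assumes "sorted_wrt (\<ge>) \<gamma>" "\<forall>i\<in>set ws. 1 \<le> i"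
    and "\<And>vs. \<forall>i\<in>set vs. 1 \<le> i \<Longrightarrow> word_act vs \<gamma> = word_act ws \<gamma> \<Longrightarrow> length ws \<le> length vs"
  shows "red (length \<gamma>) (list_fun \<gamma>) ws (list_fun (word_act ws \<gamma>))"
  using assms(2,3)
proof (induction ws)
  case Nil
  then show ?case by (simp add: red.red_Nil)
next
  case (Cons i ws)
  let ?n = "length \<gamma>" and ?g = "list_fun \<gamma>" and ?\<delta> = "word_act ws \<gamma>"
  have d: "dec ?n ?g" using assms(1) by (simp add: dec_list_fun_iff)
  have ne: "s_comp i ?\<delta> \<noteq> ?\<delta>"
    using Cons.prems(2)[of ws] Cons.prems(1) by auto
  have i: "1 \<le> i" "i < ?n" using ne by (auto simp: s_comp_def split: if_splits)
  have step: "list_fun (s_comp i ?\<delta>) = list_fun ?\<delta> \<circ> tr i"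
    using i by (intro list_fun_s_comp) simp_all
  have r: "red ?n ?g ws (list_fun ?\<delta>)"
  proof (rule Cons.IH)
    fix vs assume "\<forall>i\<in>set vs. 1 \<le> i" "word_act vs \<gamma> = ?\<delta>"
    then show "length ws \<le> length vs" using Cons.prems(2)[of "i # vs"] i by simp
  qed (use Cons.prems(1) in simp)
  have "list_fun ?\<delta> (Suc i) < list_fun ?\<delta> i"
  proof (rule ccontr)
    assume "\<not> ?thesis"
    then consider "list_fun ?\<delta> (Suc i) = list_fun ?\<delta> i" | "list_fun ?\<delta> i < list_fun ?\<delta> (Suc i)"
      by linarith
    then show False
    proof cases
      case 1
      then have "list_fun ?\<delta> \<circ> tr i = list_fun ?\<delta>" by (auto simp: fun_eq_iff tr_def)
      then have "s_comp i ?\<delta> = ?\<delta>" using step by (intro list_fun_inject) simp_all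
      then show False using ne by simp
    next
      case 2
      obtain us where us: "red ?n ?g us (list_fun ?\<delta> \<circ> tr i)" "length ws = Suc (length us)"
        using red_exchange[OF d r i 2] by blast
      have "list_fun (s_comp i ?\<delta>) = list_fun (word_act us \<gamma>)" "\<forall>i\<in>set us. 1 \<le> i"
        using red_word_act[OF us(1)] step by simp_all
      then have "word_act us \<gamma> = word_act (i # ws) \<gamma>"
        using list_fun_inject[of "word_act us \<gamma>" "s_comp i ?\<delta>"] by simp
      then show False using Cons.prems(2)[of us] \<open>\<forall>i\<in>set us. 1 \<le> i\<close> us(2) by simp
    qed
  qed
  from red.red_Cons[OF r i this] show ?case by (simp only: step word_act_Cons)
qed

lemma min_word_red:
  "red (length \<gamma>) (list_fun (sort_dec \<gamma>)) (min_word \<gamma>) (list_fun \<gamma>)"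
proof -
  let ?P = "\<lambda>ws. (\<forall>i\<in>set ws. 1 \<le> i) \<and> word_act ws (sort_dec \<gamma>) = \<gamma>"
  have "\<exists>ws. ?P ws \<and> (\<forall>vs. ?P vs \<longrightarrow> length ws \<le> length vs)"
    using word_to_sort_dec_exists[of \<gamma>] ex_has_least_nat[of ?P _ length] by blast
  then have ex: "\<exists>ws. (\<forall>i\<in>set ws. 1 \<le> i) \<and> word_act ws (sort_dec \<gamma>) = \<gamma> \<and>
      (\<forall>vs. ?P vs \<longrightarrow> length ws \<le> length vs)"
    by (simp only: conj_assoc)
  have m: "(\<forall>i\<in>set (min_word \<gamma>). 1 \<le> i) \<and> word_act (min_word \<gamma>) (sort_dec \<gamma>) = \<gamma> \<and>
      (\<forall>vs. ?P vs \<longrightarrow> length (min_word \<gamma>) \<le> length vs)"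
    unfolding min_word_def by (rule someI_ex[OF ex])
  have "red (length (sort_dec \<gamma>)) (list_fun (sort_dec \<gamma>)) (min_word \<gamma>)
      (list_fun (word_act (min_word \<gamma>) (sort_dec \<gamma>)))"
  proof (rule minimal_word_red[OF sorted_sort_dec])
    fix vs assume "\<forall>i\<in>set vs. 1 \<le> i"
      "word_act vs (sort_dec \<gamma>) = word_act (min_word \<gamma>) (sort_dec \<gamma>)"
    then show "length (min_word \<gamma>) \<le> length vs" using m by (metis (no_types, lifting))
  qed (use m in blast)
  then show ?thesis using m by (simp only: length_sort_dec)
qed

lemma atom_is_atom: "is_atom (length \<gamma>) (atom \<gamma>)"
proof -
  have "dec (length \<gamma>) (list_fun (sort_dec \<gamma>))" "supp (length \<gamma>) (list_fun (sort_dec \<gamma>))"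
    using dec_list_fun_iff[of "sort_dec \<gamma>"] sorted_sort_dec supp_list_fun[of "sort_dec \<gamma>"] by simp_all
  moreover have "atom \<gamma> = theta_word (min_word \<gamma>) (mon (length \<gamma>) (list_fun (sort_dec \<gamma>)))"
    using xpow_eq_mon[of "sort_dec \<gamma>"] by (simp add: atom_def)
  ultimately show ?thesis using min_word_red unfolding is_atom_def by blast
qed

text \<open>Frees the atom from the choice in \<open>min_word\<close>: any reduced word from the
  sorted list yields it.\<close>

lemma theta_word_xpow_eq_atom:
  assumes "sorted_wrt (\<ge>) \<delta>" "length \<gamma> = length \<delta>"
    and r: "red (length \<delta>) (list_fun \<delta>) ws (list_fun \<gamma>)"
  shows "theta_word ws (xpow \<delta>) = atom \<gamma>"
proof -
  have "list_fun \<gamma> = list_fun (word_act ws \<delta>)" using red_word_act[OF r] by blast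
  then have "\<gamma> = word_act ws \<delta>" using assms(2) by (intro list_fun_inject) simp_all
  then have "mset \<delta> = mset \<gamma>" by simp
  then have sort: "sort_dec \<gamma> = \<delta>" using assms(1) by (rule sort_dec_eqI)
  have "red (length \<delta>) (list_fun \<delta>) (min_word \<gamma>) (list_fun \<gamma>)"
    using min_word_red[of \<gamma>] unfolding sort assms(2) .
  moreover have "dec (length \<delta>) (list_fun \<delta>)" using assms(1) by (simp add: dec_list_fun_iff)
  ultimately have "theta_word (min_word \<gamma>) = theta_word ws"
    using red_theta_word_unique r by blast
  then show ?thesis by (simp add: atom_def sort)
qed

lemma is_atom_imp_atom:
  assumes "is_atom n f"
  shows "\<exists>\<gamma>. f = atom \<gamma>"
proof -
  obtain g ws h where a: "dec n g" "supp n g" "red n g ws h" "f = theta_word ws (mon n g)"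
    using assms unfolding is_atom_def by blast
  have "supp n h" by (rule red_supp[OF a(3,2)])
  then obtain \<gamma> where \<gamma>: "length \<gamma> = n" "list_fun \<gamma> = h"
    using supp_imp_list_fun by blast
  obtain \<delta> where \<delta>: "length \<delta> = n" "list_fun \<delta> = g"
    using supp_imp_list_fun[OF a(2)] by blast
  have "theta_word ws (xpow \<delta>) = atom \<gamma>"
    by (rule theta_word_xpow_eq_atom)
      (use a \<gamma> \<delta> dec_list_fun_iff[of \<delta>] in \<open>simp_all\<close>)
  then show ?thesis using a(4) \<delta> xpow_eq_mon[of \<delta>] by auto
qed

lemma atom_cone_expansion:
  assumes "f \<in> atom_cone n"
  shows "\<exists>B c. finite B \<and> f = (\<Sum>\<beta>\<in>B. of_nat (c \<beta> :: nat) * atom \<beta>)"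
  using assms
proof induction
  case zero
  show ?case by (intro exI[of _ "{}"]) simp
next
  case (atom f)
  then obtain \<gamma> where "f = atom \<gamma>" using is_atom_imp_atom by blast
  then show ?case by (intro exI[of _ "{\<gamma>}"] exI[of _ "\<lambda>_. 1"]) simp
next
  case (add f g)
  obtain B c where B: "finite B" "f = (\<Sum>\<beta>\<in>B. of_nat (c \<beta> :: nat) * atom \<beta>)"
    using add.IH(1) by blast
  obtain D d where D: "finite D" "g = (\<Sum>\<beta>\<in>D. of_nat (d \<beta> :: nat) * atom \<beta>)"
    using add.IH(2) by blast
  \<comment> \<open>Extension by zero puts both sums over the common index set
    \<open>B \<union> D\<close>.\<close>
  define c' d' where "c' \<beta> = (if \<beta> \<in> B then c \<beta> else 0)" and "d' \<beta> = (if \<beta> \<in> D then d \<beta> else 0)" for \<beta>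
  have "f = (\<Sum>\<beta>\<in>B \<union> D. of_nat (c' \<beta>) * atom \<beta>)"
    unfolding B(2) using B(1) D(1) by (intro sum.mono_neutral_cong_left) (auto simp: c'_def)
  moreover have "g = (\<Sum>\<beta>\<in>B \<union> D. of_nat (d' \<beta>) * atom \<beta>)"
    unfolding D(2) using B(1) D(1) by (intro sum.mono_neutral_cong_left) (auto simp: d'_def)
  ultimately have "f + g = (\<Sum>\<beta>\<in>B \<union> D. of_nat (c' \<beta> + d' \<beta>) * atom \<beta>)"
    by (simp add: sum.distrib distrib_right)
  then show ?case using B(1) D(1) by (intro exI[of _ "B \<union> D"] exI[of _ "\<lambda>\<beta>. c' \<beta> + d' \<beta>"]) simp
qed

theorem theorem4p1:
  fixes n :: nat and \<mu> \<alpha> :: "nat list"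
  assumes "n \<ge> 1"
    and "length \<mu> = n" and "sorted_wrt (\<ge>) \<mu>"
    and "length \<alpha> = n"
  shows "\<exists>B c. finite B \<and>
           atom \<mu> * atom \<alpha> = (\<Sum>\<beta>\<in>B. of_nat (c \<beta> :: nat) * atom \<beta>)"
proof -
  have dec: "dec n (list_fun \<mu>)" and supp: "supp n (list_fun \<mu>)"
    using assms(2,3) dec_list_fun_iff[of \<mu>] supp_list_fun[of \<mu>] by simp_all
  \<comment> \<open>A partition is reached from itself by the empty word, so its atom is the
    monomial.\<close>
  have \<mu>: "atom \<mu> = mon n (list_fun \<mu>)"
    using theta_word_xpow_eq_atom[OF assms(3) refl red.red_Nil] assms(2) by (simp add: xpow_eq_mon)
  have "atom \<alpha> \<in> atom_cone n"
    using atom_is_atom[of \<alpha>] assms(4) by (intro atom_cone.atom) simp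
  then have "atom \<mu> * atom \<alpha> \<in> atom_cone n"
    unfolding \<mu> using supp by (intro dec_mon_mult_atom_cone[OF dec order_refl]) (simp_all add: supp_def)
  then show ?thesis by (rule atom_cone_expansion)
qed

end
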